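(* Let $p(x,y,z)$ and $q(x,y,z)$ be linearly independent homogeneous polynomials of degree two with complex coefficients. Then the polynomial $r(x,y,z)=\alpha p(x,y,z)+\beta q(x,y,z)$ is a product of polynomials of first degree for all $\alpha,\beta\in\mathbb{C}$ if and only if at least one of the following conditions holds: (a) $p$ and $q$ have a common factor of first degree: $p=\ell\,\ell_1$ and $q=\ell\,\ell_2$ for some $\ell,\ell_1,\ell_2\in\dot\Pi_1^3$; (b) $p(x,y,z)=f(s,t)$ and $q(x,y,z)=g(s,t)$, where $f,g\in\dot\Pi_2^2$ are bivariate homogeneous polynomials of degree two and $s,t\in\dot\Pi_1^3$, that is, $s=a_1x+b_1y+c_1z$ and $t=a_2x+b_2y+c_2z$ for some $a_i,b_i,c_i\in\mathbb{C}$.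
   Context: All polynomials have complex coefficients. $\dot\Pi_n^k$ denotes the vector space of homogeneous polynomials of degree $n$ in $k$ variables with complex coefficients (including the zero polynomial); e.g. $\dot\Pi_n^3=\{\sum_{i+j+k=n}a_{ijk}x^iy^jz^k\}$. A polynomial in $\dot\Pi_2^3$ is said to be a product of polynomials of first degree (factorizable) if it equals $m_1m_2$ with $m_1,m_2\in\dot\Pi_1^3$; in particular, the zero polynomial counts as such a product. *)

theory Defs
  imports Complex_Main "HOL-Library.Poly_Mapping"
begin

text \<open>
  Complex polynomials in variables indexed by the natural numbers: a monomial is a finitely
  supported exponent vector, and a polynomial maps each monomial to its coefficient.
  Addition and multiplication are those of \<^theory>\<open>HOL-Library.Poly_Mapping\<close>.
  The variables $x, y, z$ have the indices 0, 1, 2.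
\<close>

type_synonym monom = "nat \<Rightarrow>\<^sub>0 nat"

type_synonym cpoly = "monom \<Rightarrow>\<^sub>0 complex"

definition Const :: "complex \<Rightarrow> cpoly" where
  "Const c = Poly_Mapping.single 0 c"

definition Var :: "nat \<Rightarrow> cpoly" where
  "Var i = Poly_Mapping.single (Poly_Mapping.single i 1) 1"

definition total_deg :: "monom \<Rightarrow> nat" where
  "total_deg m = (\<Sum>i\<in>Poly_Mapping.keys m. Poly_Mapping.lookup m i)"

text \<open>
  \<open>Hom n k\<close> is $\dot\Pi_n^k$. It contains the zero polynomial, which has no monomials.
\<close>

definition Hom :: "nat \<Rightarrow> nat \<Rightarrow> cpoly set" where
  "Hom n k = {p. \<forall>m\<in>Poly_Mapping.keys p. Poly_Mapping.keys m \<subseteq> {..<k} \<and> total_deg m = n}"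

definition lin_indep :: "cpoly \<Rightarrow> cpoly \<Rightarrow> bool" where
  "lin_indep p q \<longleftrightarrow>
     (\<forall>\<alpha> \<beta>. Const \<alpha> * p + Const \<beta> * q = 0 \<longrightarrow> \<alpha> = 0 \<and> \<beta> = 0)"

definition factorizable :: "cpoly \<Rightarrow> bool" where
  "factorizable r \<longleftrightarrow> (\<exists>m\<^sub>1\<in>Hom 1 3. \<exists>m\<^sub>2\<in>Hom 1 3. r = m\<^sub>1 * m\<^sub>2)"

text \<open>\<open>subst \<sigma> f\<close> replaces each variable \<open>i\<close> of \<open>f\<close> by the polynomial \<open>\<sigma> i\<close>.\<close>

definition subst :: "(nat \<Rightarrow> cpoly) \<Rightarrow> cpoly \<Rightarrow> cpoly" where
  "subst \<sigma> f = (\<Sum>m\<in>Poly_Mapping.keys f.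
      Const (Poly_Mapping.lookup f m) *
      (\<Prod>i\<in>Poly_Mapping.keys m. \<sigma> i ^ Poly_Mapping.lookup m i))"

text \<open>The composition $f(s,t)$ of a bivariate polynomial, with variables 0 and 1.\<close>

definition subst2 :: "cpoly \<Rightarrow> cpoly \<Rightarrow> cpoly \<Rightarrow> cpoly" where
  "subst2 f s t = subst (\<lambda>i. if i = 0 then s else t) f"

end

theory Submission
  imports Defs
begin

text \<open>
  Write the two members of the pencil as $p = uv$ and $q = mn$ with linear forms $u, v, m, n$.
  Geometrically these are two reducible conics, and the question is when every conic of the
  pencil is reducible. A reducible conic has a singular Hessian matrix, and the Hessian
  determinant of the pencil is, by a Cauchy-Binet expansion,
  \[ \det H(\alpha uv + \beta mn)
     = - 2 \alpha^2 \beta\, [u v m] [u v n] - 2 \alpha \beta^2\, [u m n] [v m n], \]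
  where $[a b c]$ is the determinant of three coefficient vectors
  (\<open>hess_det_factorizable\<close>, \<open>hess_det_pencil\<close>). If it vanishes for all $\alpha, \beta$, then both
  products of brackets are zero. Exchanging $u$ with $v$, or $m$ with $n$, changes neither $p$ nor
  $q$, so one may assume $[u v m] = [u m n] = 0$. Both relations contain the pair $u, m$. If this
  pair is proportional, then $p$ and $q$ share a linear factor. Otherwise $v$ and $n$ lie in the
  span of $u$ and $m$, so that $p$ and $q$ are binary forms in $s = u$ and $t = m$
  (\<open>shared_dependence_cases\<close>).

  Conversely, a common factor divides every member of the pencil, and the cofactor is linear. In
  the other case each member is a binary quadratic form in $s, t$, which splits into linear
  factors since the complex numbers contain the square root of its discriminant
  (\<open>binary_quadratic_splits\<close>).
\<close>

section \<open>Linear forms and their coefficient vectors\<close>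

text \<open>
  Only the entries 0, 1, 2 of the vector matter. Vectors are functions on all natural numbers so
  that their indices coincide with those of the variables.
\<close>

definition lin :: "(nat \<Rightarrow> complex) \<Rightarrow> cpoly" where
  "lin a = Const (a 0) * Var 0 + Const (a 1) * Var 1 + Const (a 2) * Var 2"

lemma Const_mult: "Const a * Const b = Const (a * b)"
  by (simp add: Const_def mult_single)

lemma Const_add: "Const a + Const b = Const (a + b)"
  by (simp add: Const_def single_add)

lemma Const_zero [simp]: "Const 0 = 0"
  by (simp add: Const_def)

lemma Const_one [simp]: "Const 1 = 1"
  by (simp add: Const_def)

lemma lin_combination: "Const c * lin u + Const d * lin v = lin (\<lambda>i. c * u i + d * v i)"
  by (simp add: lin_def Const_mult [symmetric] Const_add [symmetric] algebra_simps)

lemma lin_scale: "Const c * lin u = lin (\<lambda>i. c * u i)"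
  by (simp add: lin_def Const_mult [symmetric] algebra_simps)

lemma lin_cong:
  assumes "a 0 = b 0" "a 1 = b 1" "a 2 = b 2"
  shows "lin a = lin b"
  using assms by (simp add: lin_def)

lemma total_deg_superset:
  assumes "finite A" "Poly_Mapping.keys m \<subseteq> A"
  shows "total_deg m = (\<Sum>i\<in>A. Poly_Mapping.lookup m i)"
  unfolding total_deg_def
  by (rule sum.mono_neutral_left) (use assms in \<open>auto simp: in_keys_iff\<close>)

lemma Hom_add: "p \<in> Hom n k \<Longrightarrow> q \<in> Hom n k \<Longrightarrow> p + q \<in> Hom n k"
  unfolding Hom_def using Poly_Mapping.keys_add [of p q] by blast

lemma single_in_Hom:
  assumes "Poly_Mapping.keys m \<subseteq> {..<k}" "total_deg m = n"
  shows "Poly_Mapping.single m c \<in> Hom n k"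
  using assms by (simp add: Hom_def)

lemma lookup_outside_Hom:
  assumes "p \<in> Hom n k" "\<not> (Poly_Mapping.keys m \<subseteq> {..<k} \<and> total_deg m = n)"
  shows "Poly_Mapping.lookup p m = 0"
  using assms by (auto simp: Hom_def in_keys_iff)

lemma Const_times_Var: "Const c * Var i = Poly_Mapping.single (Poly_Mapping.single i 1) c"
  by (simp add: Const_def Var_def mult_single)

lemma lin_in_Hom: "lin a \<in> Hom 1 3"
  unfolding lin_def Const_times_Var
  by (intro Hom_add single_in_Hom) (auto simp: total_deg_def)

lemma degree_one_monomial:
  assumes "Poly_Mapping.keys m \<subseteq> {..<3}" "total_deg m = 1"
  shows "\<exists>i<3. m = Poly_Mapping.single i 1"
proof -
  have s: "Poly_Mapping.lookup m 0 + Poly_Mapping.lookup m 1 + Poly_Mapping.lookup m 2 = 1"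
    using assms total_deg_superset [of "{..<3}" m] by (simp add: eval_nat_numeral)
  then obtain i where "i < 3" and i: "Poly_Mapping.lookup m i = 1"
    "\<And>j. j < 3 \<Longrightarrow> j \<noteq> i \<Longrightarrow> Poly_Mapping.lookup m j = 0"
  proof -
    have *: "j = 0 \<or> j = 1 \<or> j = 2" if "j < 3" for j :: nat using that by auto
    consider "Poly_Mapping.lookup m 0 = 1" | "Poly_Mapping.lookup m 1 = 1"
      | "Poly_Mapping.lookup m 2 = 1" using s by linarith
    then show thesis
    proof cases
      case 1 then show thesis using s that [of 0] * by force
    next
      case 2 then show thesis using s that [of 1] * by force
    next
      case 3 then show thesis using s that [of 2] * by force
    qed
  qed
  have "Poly_Mapping.lookup m j = 0" if "j \<ge> 3" for j
    using that assms(1) by (metis in_keys_iff lessThan_iff not_le subsetD)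
  then have "m = Poly_Mapping.single i 1"
    using i by (intro poly_mapping_eqI) (metis lookup_single_eq lookup_single_not_eq not_le)
  with \<open>i < 3\<close> show ?thesis by blast
qed

lemma Hom_1_3_lin:
  assumes "l \<in> Hom 1 3"
  obtains a where "l = lin a"
proof
  let ?e = "\<lambda>i::nat. Poly_Mapping.single i (1::nat)"
  show "l = lin (\<lambda>i. Poly_Mapping.lookup l (?e i))"
  proof (rule poly_mapping_eqI)
    fix m
    show "Poly_Mapping.lookup l m =
      Poly_Mapping.lookup (lin (\<lambda>i. Poly_Mapping.lookup l (?e i))) m"
    proof (cases "\<exists>i<3. m = ?e i")
      case True
      then consider "m = ?e 0" | "m = ?e 1" | "m = ?e 2"
        by (metis One_nat_def less_Suc_eq less_zeroE numeral_2_eq_2 numeral_3_eq_3)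
      then show ?thesis
        by cases (auto simp: lin_def Const_times_Var lookup_add lookup_single when_def
            dest!: arg_cong [of _ _ Poly_Mapping.keys])
    next
      case False
      with degree_one_monomial [of m] lookup_outside_Hom [OF assms, of m]
      have "Poly_Mapping.lookup l m = 0" by blast
      moreover have "?e 0 \<noteq> m" "?e 1 \<noteq> m" "?e 2 \<noteq> m"
        using False zero_less_numeral one_less_numeral_iff numeral_less_iff semiring_norm by metis+
      ultimately show ?thesis
        by (auto simp: lin_def Const_times_Var lookup_add lookup_single when_def)
    qed
  qed
qed

section \<open>The Hessian determinant\<close>

text \<open>
  These are the second partial derivatives of a quadratic form: the coefficient of a square
  counts twice. With this normalisation the product of two linear forms has the symmetric matrix
  $a b^T + b a^T$, without denominators.
\<close>

definition hess :: "cpoly \<Rightarrow> nat \<Rightarrow> nat \<Rightarrow> complex" where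
  "hess r i j = (if i = j then 2 else 1) *
     Poly_Mapping.lookup r (Poly_Mapping.single i 1 + Poly_Mapping.single j 1)"

definition hess_det :: "cpoly \<Rightarrow> complex" where
  "hess_det r =
     hess r 0 0 * (hess r 1 1 * hess r 2 2 - hess r 1 2 * hess r 2 1)
   - hess r 0 1 * (hess r 1 0 * hess r 2 2 - hess r 1 2 * hess r 2 0)
   + hess r 0 2 * (hess r 1 0 * hess r 2 1 - hess r 1 1 * hess r 2 0)"

definition det3 :: "(nat \<Rightarrow> complex) \<Rightarrow> (nat \<Rightarrow> complex) \<Rightarrow> (nat \<Rightarrow> complex) \<Rightarrow> complex" where
  "det3 u v w =
     u 0 * (v 1 * w 2 - v 2 * w 1)
   - u 1 * (v 0 * w 2 - v 2 * w 0)
   + u 2 * (v 0 * w 1 - v 1 * w 0)"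

lemma quadratic_monomial_eq_iff:
  "Poly_Mapping.single i (1::nat) + Poly_Mapping.single j 1 =
     Poly_Mapping.single k 1 + Poly_Mapping.single l 1
   \<longleftrightarrow> (i = k \<and> j = l) \<or> (i = l \<and> j = k)" (is "?L = ?R \<longleftrightarrow> _")
proof
  assume "?L = ?R"
  then have "Poly_Mapping.lookup ?L n = Poly_Mapping.lookup ?R n" for n
    by simp
  note this [of i] this [of j] this [of k] this [of l]
  then show "(i = k \<and> j = l) \<or> (i = l \<and> j = k)"
    by (auto simp: lookup_add lookup_single when_def split: if_splits)
qed (auto simp: add.commute)

lemma hess_add: "hess (r + r') i j = hess r i j + hess r' i j"
  by (simp add: hess_def lookup_add algebra_simps)

lemma lin_eq_sum: "lin a = (\<Sum>i<3. Const (a i) * Var i)"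
  by (simp add: lin_def eval_nat_numeral)

text \<open>
  The uncollected double sum is kept on purpose. A coefficient is then read off by deciding which
  index pairs give the same monomial, which is \<open>quadratic_monomial_eq_iff\<close>.
\<close>

lemma lin_mult_lin:
  "lin a * lin b = (\<Sum>i<3. \<Sum>j<3. Poly_Mapping.single
     (Poly_Mapping.single i 1 + Poly_Mapping.single j 1) (a i * b j))"
  by (simp only: lin_eq_sum Const_times_Var sum_product mult_single)

lemma indices_less_3: "(0::nat) < 3" "(1::nat) < 3" "(2::nat) < 3"
  by simp_all

lemma hess_lin_mult_lin:
  assumes "k < 3" "l < 3"
  shows "hess (lin a * lin b) k l = a k * b l + a l * b k"
proof -
  have *: "x = 0 \<or> x = 1 \<or> x = 2" if "x < 3" for x :: nat using that by auto
  have "Poly_Mapping.lookup (lin a * lin b) (Poly_Mapping.single k 1 + Poly_Mapping.single l 1) =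
    (\<Sum>i<3. \<Sum>j<3. if (i = k \<and> j = l) \<or> (i = l \<and> j = k) then a i * b j else 0)"
    by (simp only: lin_mult_lin lookup_sum lookup_single when_def quadratic_monomial_eq_iff)
  then have "hess (lin a * lin b) k l = (if k = l then 2 else 1) *
    (\<Sum>i<3. \<Sum>j<3. if (i = k \<and> j = l) \<or> (i = l \<and> j = k) then a i * b j else 0)"
    by (simp only: hess_def)
  then show ?thesis
    using * [OF assms(1)] * [OF assms(2)]
    by (elim disjE) (simp_all add: numeral_3_eq_3 numeral_2_eq_2)
qed

text \<open>The matrix $a b^T + b a^T$ has rank at most two.\<close>

lemma hess_det_factorizable:
  assumes "factorizable r"
  shows "hess_det r = 0"
proof -
  have "hess_det (lin a * lin b) = 0" for a b
    by (simp only: hess_det_def hess_lin_mult_lin indices_less_3) algebra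
  with assms show ?thesis
    unfolding factorizable_def by (metis Hom_1_3_lin)
qed

text \<open>
  Cauchy-Binet: the matrix $u v^T + v u^T + m n^T + n m^T$ is the product of the $3 \times 4$ matrix
  with columns $u, v, m, n$ and the $4 \times 3$ matrix with rows $v, u, n, m$. The four
  products of corresponding $3 \times 3$ minors are equal in pairs, each with the sign $-1$ of a
  transposition, whence the factor $-2$.
\<close>

lemma hess_det_sum_of_products:
  "hess_det (lin u * lin v + lin m * lin n) =
     - 2 * (det3 u v m * det3 u v n + det3 u m n * det3 v m n)"
  by (simp only: hess_det_def det3_def hess_add hess_lin_mult_lin indices_less_3) algebra

lemma hess_det_pencil:
  "hess_det (Const \<alpha> * (lin u * lin v) + Const \<beta> * (lin m * lin n)) =
     - 2 * \<alpha>\<^sup>2 * \<beta> * (det3 u v m * det3 u v n) - 2 * \<alpha> * \<beta>\<^sup>2 * (det3 u m n * det3 v m n)"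
proof -
  have eq: "Const \<alpha> * (lin u * lin v) + Const \<beta> * (lin m * lin n) =
    lin (\<lambda>i. \<alpha> * u i) * lin v + lin (\<lambda>i. \<beta> * m i) * lin n"
    by (simp only: lin_scale [symmetric] mult.assoc)
  have "det3 (\<lambda>i. \<alpha> * u i) v w = \<alpha> * det3 u v w" "det3 w (\<lambda>i. \<beta> * m i) n = \<beta> * det3 w m n"
    "det3 w v (\<lambda>i. \<beta> * m i) = \<beta> * det3 w v m" for v w n
    by (simp_all add: det3_def algebra_simps)
  then show ?thesis
    unfolding eq hess_det_sum_of_products by (simp add: algebra_simps power2_eq_square)
qed

text \<open>
  The determinant of the pencil, as a polynomial in $\alpha, \beta$, has only the two coefficients
  of $\alpha^2 \beta$ and $\alpha \beta^2$, so the two members $(1, 1)$ and $(1, -1)$ suffice to see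
  that both vanish.
\<close>

lemma factorizable_pencil_det3:
  assumes "\<And>\<alpha> \<beta>. factorizable (Const \<alpha> * (lin u * lin v) + Const \<beta> * (lin m * lin n))"
  shows "det3 u v m * det3 u v n = 0" "det3 u m n * det3 v m n = 0"
proof -
  have eq: "- 2 * \<alpha>\<^sup>2 * \<beta> * (det3 u v m * det3 u v n) - 2 * \<alpha> * \<beta>\<^sup>2 * (det3 u m n * det3 v m n) = 0"
    for \<alpha> \<beta>
    using hess_det_factorizable [OF assms] by (simp add: hess_det_pencil)
  from eq [of 1 1] have "- (det3 u v m * det3 u v n) = det3 u m n * det3 v m n"
    by simp
  moreover from eq [of 1 "-1"] have eq': "det3 u v m * det3 u v n = det3 u m n * det3 v m n"
    by simp
  ultimately show "det3 u v m * det3 u v n = 0"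
    by (metis mult_2 add.right_inverse mult_eq_0_iff zero_neq_numeral)
  with eq' show "det3 u m n * det3 v m n = 0"
    by (simp only:)
qed

section \<open>Linear dependence of three linear forms\<close>

text \<open>Cramer's rule for two equations.\<close>

lemma span_from_minor:
  fixes a b c d :: complex
  assumes "a * d - b * c \<noteq> 0"
  shows "\<exists>x y. x * a + y * c = e \<and> x * b + y * d = f"
proof (intro exI conjI)
  show "(e * d - f * c) / (a * d - b * c) * a + (a * f - b * e) / (a * d - b * c) * c = e"
    using assms by (simp add: add_divide_distrib [symmetric] nonzero_divide_eq_eq) algebra
  show "(e * d - f * c) / (a * d - b * c) * b + (a * f - b * e) / (a * d - b * c) * d = f"
    using assms by (simp add: add_divide_distrib [symmetric] nonzero_divide_eq_eq) algebra
qed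

text \<open>
  If all $2 \times 2$ minors of $u, m$ vanish, the two are proportional; both directions are listed
  because either form may be zero. Otherwise some minor is nonzero: Cramer's rule matches $w$ in
  the two coordinates of that minor, and the vanishing determinant, which is up to sign the minor
  times the defect in the third coordinate, forces agreement there too.
\<close>

lemma proportional_or_span:
  obtains (fst_multiple) c where "lin u = Const c * lin m"
  | (snd_multiple) c where "lin m = Const c * lin u"
  | (span) "\<And>w. det3 u m w = 0 \<Longrightarrow> \<exists>c d. lin w = Const c * lin u + Const d * lin m"
proof (cases "u 0 * m 1 - u 1 * m 0 = 0 \<and> u 0 * m 2 - u 2 * m 0 = 0 \<and> u 1 * m 2 - u 2 * m 1 = 0")
  case True
  then have min: "u 0 * m 1 = u 1 * m 0" "u 0 * m 2 = u 2 * m 0" "u 1 * m 2 = u 2 * m 1"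
    by auto
  consider "m 0 \<noteq> 0" | "m 1 \<noteq> 0" | "m 2 \<noteq> 0" | "m 0 = 0" "m 1 = 0" "m 2 = 0" by blast
  then show thesis
  proof cases
    case 1
    then have "lin u = Const (u 0 / m 0) * lin m"
      unfolding lin_scale by (intro lin_cong) (use min in \<open>simp_all add: nonzero_eq_divide_eq mult_ac\<close>)
    then show thesis by (rule fst_multiple)
  next
    case 2
    then have "lin u = Const (u 1 / m 1) * lin m"
      unfolding lin_scale by (intro lin_cong) (use min in \<open>simp_all add: nonzero_eq_divide_eq mult_ac\<close>)
    then show thesis by (rule fst_multiple)
  next
    case 3
    then have "lin u = Const (u 2 / m 2) * lin m"
      unfolding lin_scale by (intro lin_cong) (use min in \<open>simp_all add: nonzero_eq_divide_eq mult_ac\<close>)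
    then show thesis by (rule fst_multiple)
  next
    case 4
    then show thesis by (intro snd_multiple [of 0]) (simp add: lin_def)
  qed
next
  case False
  show thesis
  proof (rule span)
    fix w
    assume det: "det3 u m w = 0"
    consider "u 0 * m 1 - u 1 * m 0 \<noteq> 0" | "u 0 * m 2 - u 2 * m 0 \<noteq> 0"
      | "u 1 * m 2 - u 2 * m 1 \<noteq> 0"
      using False by blast
    then have "\<exists>c d. c * u 0 + d * m 0 = w 0 \<and> c * u 1 + d * m 1 = w 1 \<and> c * u 2 + d * m 2 = w 2"
    proof cases
      case 1
      then obtain c d where cd: "c * u 0 + d * m 0 = w 0" "c * u 1 + d * m 1 = w 1"
        using span_from_minor by blast
      have "(u 0 * m 1 - u 1 * m 0) * (c * u 2 + d * m 2 - w 2) = 0"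
        using det unfolding det3_def cd [symmetric] by algebra
      with 1 cd show ?thesis by auto
    next
      case 2
      then obtain c d where cd: "c * u 0 + d * m 0 = w 0" "c * u 2 + d * m 2 = w 2"
        using span_from_minor by blast
      have "(u 0 * m 2 - u 2 * m 0) * (c * u 1 + d * m 1 - w 1) = 0"
        using det unfolding det3_def cd [symmetric] by algebra
      with 2 cd show ?thesis by auto
    next
      case 3
      then obtain c d where cd: "c * u 1 + d * m 1 = w 1" "c * u 2 + d * m 2 = w 2"
        using span_from_minor by blast
      have "(u 1 * m 2 - u 2 * m 1) * (c * u 0 + d * m 0 - w 0) = 0"
        using det unfolding det3_def cd [symmetric] by algebra
      with 3 cd show ?thesis by auto
    qed
    then show "\<exists>c d. lin w = Const c * lin u + Const d * lin m"
      unfolding lin_combination by (metis (no_types, lifting) lin_cong)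
  qed
qed

lemma det3_swap_fst: "det3 v u w = - det3 u v w"
  and det3_swap_snd: "det3 u w v = - det3 u v w"
  unfolding det3_def by algebra+

section \<open>Binary quadratic forms\<close>

definition binary_quadratic :: "complex \<Rightarrow> complex \<Rightarrow> complex \<Rightarrow> cpoly" where
  "binary_quadratic a b c =
     Poly_Mapping.single (Poly_Mapping.single 0 2) a
   + Poly_Mapping.single (Poly_Mapping.single 0 1 + Poly_Mapping.single 1 1) b
   + Poly_Mapping.single (Poly_Mapping.single 1 2) c"

lemma keys_mixed: "Poly_Mapping.keys (Poly_Mapping.single 0 (1::nat) + Poly_Mapping.single (1::nat) 1) = {0, 1}"
  by (auto simp: in_keys_iff lookup_add lookup_single when_def split: if_splits)

lemma binary_quadratic_in_Hom: "binary_quadratic a b c \<in> Hom 2 2"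
  unfolding binary_quadratic_def
  by (intro Hom_add single_in_Hom)
    (simp_all add: total_deg_def keys_mixed lookup_add lookup_single
      del: One_nat_def single_numeral single_one)

lemma degree_two_binary_monomial:
  assumes "Poly_Mapping.keys m \<subseteq> {..<2}" "total_deg m = 2"
  shows "m \<in> {Poly_Mapping.single 0 2, Poly_Mapping.single 0 1 + Poly_Mapping.single 1 1,
    Poly_Mapping.single 1 2}"
proof -
  have s: "Poly_Mapping.lookup m 0 + Poly_Mapping.lookup m 1 = 2"
    using assms total_deg_superset [of "{..<2}" m] by (simp add: eval_nat_numeral)
  have m: "m = Poly_Mapping.single 0 (Poly_Mapping.lookup m 0)
    + Poly_Mapping.single 1 (Poly_Mapping.lookup m 1)"
  proof (rule poly_mapping_eqI)
    fix i
    show "Poly_Mapping.lookup m i = Poly_Mapping.lookup (Poly_Mapping.single 0 (Poly_Mapping.lookup m 0)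
      + Poly_Mapping.single 1 (Poly_Mapping.lookup m 1)) i"
    proof (cases "i < 2")
      case True
      then show ?thesis by (auto simp: lookup_add lookup_single less_2_cases_iff)
    next
      case False
      then have "i \<notin> Poly_Mapping.keys m" using assms(1) by auto
      with False show ?thesis by (simp add: lookup_add lookup_single when_def in_keys_iff)
    qed
  qed
  consider "Poly_Mapping.lookup m 0 = 0" "Poly_Mapping.lookup m 1 = 2"
    | "Poly_Mapping.lookup m 0 = 1" "Poly_Mapping.lookup m 1 = 1"
    | "Poly_Mapping.lookup m 0 = 2" "Poly_Mapping.lookup m 1 = 0"
    using s by linarith
  then show ?thesis
    by cases (use m in auto)
qed

lemma binary_monomials_distinct:
  shows "Poly_Mapping.single 0 2 \<noteq> (Poly_Mapping.single 0 1 + Poly_Mapping.single 1 1 :: monom)"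
  and "Poly_Mapping.single 0 2 \<noteq> (Poly_Mapping.single 1 2 :: monom)"
  and "Poly_Mapping.single 0 1 + Poly_Mapping.single 1 1 \<noteq> (Poly_Mapping.single 1 2 :: monom)"
  by (auto dest!: arg_cong [of _ _ "\<lambda>m. Poly_Mapping.lookup m 0"]
      simp: lookup_add lookup_single simp del: single_numeral single_one)

text \<open>
  Substitution depends only on three coefficients of \<open>f\<close>, because the monomials outside the
  three listed in \<open>degree_two_binary_monomial\<close> have coefficient zero. Summing over this fixed set
  instead of the keys of \<open>f\<close> makes the result linear in \<open>f\<close>.
\<close>

lemma subst2_Hom_2_2:
  assumes "f \<in> Hom 2 2"
  shows "subst2 f s t =
     Const (Poly_Mapping.lookup f (Poly_Mapping.single 0 2)) * s\<^sup>2
   + Const (Poly_Mapping.lookup f (Poly_Mapping.single 0 1 + Poly_Mapping.single 1 1)) * (s * t)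
   + Const (Poly_Mapping.lookup f (Poly_Mapping.single 1 2)) * t\<^sup>2"
proof -
  let ?M = "{Poly_Mapping.single 0 2, Poly_Mapping.single 0 1 + Poly_Mapping.single 1 1,
    Poly_Mapping.single 1 2} :: monom set"
  let ?\<sigma> = "\<lambda>i::nat. if i = 0 then s else t"
  have "Poly_Mapping.keys f \<subseteq> ?M"
    using assms degree_two_binary_monomial unfolding Hom_def by blast
  then have "subst2 f s t = (\<Sum>m\<in>?M. Const (Poly_Mapping.lookup f m) *
      (\<Prod>i\<in>Poly_Mapping.keys m. ?\<sigma> i ^ Poly_Mapping.lookup m i))"
    unfolding subst2_def subst_def
    by (intro sum.mono_neutral_left) (auto simp: in_keys_iff simp del: One_nat_def)
  then show ?thesis
    using binary_monomials_distinct
    by (simp add: keys_mixed lookup_add lookup_single add.assoc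
        del: One_nat_def single_numeral single_one)
qed

lemma subst2_binary_quadratic:
  "subst2 (binary_quadratic a b c) s t = Const a * s\<^sup>2 + Const b * (s * t) + Const c * t\<^sup>2"
  unfolding subst2_Hom_2_2 [OF binary_quadratic_in_Hom]
  using binary_monomials_distinct
  by (auto simp: binary_quadratic_def lookup_add lookup_single when_def
      simp del: One_nat_def single_numeral single_one)

text \<open>
  This says that $A s^2 + B s t + D t^2 = (a s + b t)(c s + d t)$ is solvable. For $A = 0$ the form
  is $t (B s + D t)$; otherwise the quadratic formula gives the roots.
\<close>

lemma binary_quadratic_splits:
  fixes A B D :: complex
  shows "\<exists>a b c d. A = a * c \<and> B = a * d + b * c \<and> D = b * d"
proof (cases "A = 0")
  case True
  then have "A = 0 * B \<and> B = 0 * D + 1 * B \<and> D = 1 * D"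
    by simp
  then show ?thesis by blast
next
  case False
  define e where "e = csqrt (B\<^sup>2 - 4 * A * D)"
  have "e\<^sup>2 = B\<^sup>2 - 4 * A * D"
    by (simp add: e_def)
  then have "A = A * 1 \<and> B = A * ((B - e) / (2 * A)) + (B + e) / 2 * 1
    \<and> D = (B + e) / 2 * ((B - e) / (2 * A))"
    using False by (simp add: field_simps power2_eq_square)
  then show ?thesis by blast
qed

lemma factorizable_binary:
  assumes "s \<in> Hom 1 3" "t \<in> Hom 1 3"
  shows "factorizable (Const A * s\<^sup>2 + Const B * (s * t) + Const D * t\<^sup>2)"
proof -
  obtain u v where uv: "s = lin u" "t = lin v"
    using assms by (metis Hom_1_3_lin)
  obtain a b c d where "A = a * c" "B = a * d + b * c" "D = b * d"
    using binary_quadratic_splits by blast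
  then have "Const A * s\<^sup>2 + Const B * (s * t) + Const D * t\<^sup>2
    = (Const a * s + Const b * t) * (Const c * s + Const d * t)"
    by (simp add: Const_add [symmetric] Const_mult [symmetric] algebra_simps power2_eq_square)
  then show ?thesis
    unfolding factorizable_def uv lin_combination using lin_in_Hom by blast
qed

section \<open>Pencils of reducible conics\<close>

text \<open>
  Here the pair $u, m$, one factor from each product, occurs in both dependences, so each of the
  remaining factors $v$ and $n$ is tied to the same pair. With $v = a u + b m$ and
  $n = c u + d m$ the binary forms are $a s^2 + b s t$ and $c s t + d t^2$.
\<close>

lemma shared_dependence_cases:
  assumes "det3 u v m = 0" "det3 u m n = 0"
  shows "(\<exists>l\<in>Hom 1 3. \<exists>l\<^sub>1\<in>Hom 1 3. \<exists>l\<^sub>2\<in>Hom 1 3.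
            lin u * lin v = l * l\<^sub>1 \<and> lin m * lin n = l * l\<^sub>2) \<or>
    (\<exists>f\<in>Hom 2 2. \<exists>g\<in>Hom 2 2. \<exists>s\<in>Hom 1 3. \<exists>t\<in>Hom 1 3.
        lin u * lin v = subst2 f s t \<and> lin m * lin n = subst2 g s t)"
proof (cases rule: proportional_or_span [of u m])
  case (fst_multiple c)
  then have "lin u * lin v = lin m * lin (\<lambda>i. c * v i)"
    by (simp add: lin_scale [symmetric] algebra_simps)
  then show ?thesis using lin_in_Hom by blast
next
  case (snd_multiple c)
  then have "lin m * lin n = lin u * lin (\<lambda>i. c * n i)"
    by (simp add: lin_scale [symmetric] algebra_simps)
  then show ?thesis using lin_in_Hom by blast
next
  case span
  have "det3 u m v = 0"
    using assms(1) by (simp add: det3_swap_snd [of u m v])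
  then obtain a b where v: "lin v = Const a * lin u + Const b * lin m"
    using span by blast
  obtain c d where n: "lin n = Const c * lin u + Const d * lin m"
    using span assms(2) by blast
  have "lin u * lin v = subst2 (binary_quadratic a b 0) (lin u) (lin m)"
    "lin m * lin n = subst2 (binary_quadratic 0 c d) (lin u) (lin m)"
    by (simp_all add: v n subst2_binary_quadratic algebra_simps power2_eq_square)
  then show ?thesis
    using lin_in_Hom binary_quadratic_in_Hom by blast
qed

theorem theorem2p1:
  fixes p q :: cpoly
  assumes "p \<in> Hom 2 3" and "q \<in> Hom 2 3" and "lin_indep p q"
  shows "(\<forall>\<alpha> \<beta> :: complex. factorizable (Const \<alpha> * p + Const \<beta> * q)) \<longleftrightarrow>
    (\<exists>l\<in>Hom 1 3. \<exists>l\<^sub>1\<in>Hom 1 3. \<exists>l\<^sub>2\<in>Hom 1 3. p = l * l\<^sub>1 \<and> q = l * l\<^sub>2) \<or>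
    (\<exists>f\<in>Hom 2 2. \<exists>g\<in>Hom 2 2. \<exists>s\<in>Hom 1 3. \<exists>t\<in>Hom 1 3.
        p = subst2 f s t \<and> q = subst2 g s t)"
    (is "?factors \<longleftrightarrow> ?common \<or> ?binary")
proof
  assume factors: ?factors
  then have "factorizable p" "factorizable q"
    by (force dest: spec [of _ 1] spec [of _ 0])+
  then obtain u v m n where p: "p = lin u * lin v" and q: "q = lin m * lin n"
    unfolding factorizable_def by (metis Hom_1_3_lin)
  have "det3 u v m = 0 \<or> det3 u v n = 0" "det3 u m n = 0 \<or> det3 v m n = 0"
    using factorizable_pencil_det3 [of u v m n] factors p q by auto
  \<comment> \<open>In each of the four combinations the two brackets share exactly one factor of each product;
    reordering the factors brings that pair to the place of $u, m$.\<close>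
  then consider "det3 u v m = 0" "det3 u m n = 0" | "det3 v u m = 0" "det3 v m n = 0"
    | "det3 u v n = 0" "det3 u n m = 0" | "det3 v u n = 0" "det3 v n m = 0"
    by (auto simp: det3_swap_fst [of v u] det3_swap_snd [of _ n m])
  then show "?common \<or> ?binary"
    unfolding p q
    using shared_dependence_cases [of u v m n] shared_dependence_cases [of v u m n]
      shared_dependence_cases [of u v n m] shared_dependence_cases [of v u n m]
    by cases (simp_all only: mult.commute [of "lin v" "lin u"] mult.commute [of "lin n" "lin m"])
next
  assume "?common \<or> ?binary"
  then show ?factors
  proof
    assume ?common
    then obtain l l1 l2 where hom: "l \<in> Hom 1 3" "l1 \<in> Hom 1 3" "l2 \<in> Hom 1 3"
      and pq: "p = l * l1" "q = l * l2"
      by blast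
    obtain a b where ab: "l1 = lin a" "l2 = lin b"
      using hom by (metis Hom_1_3_lin)
    have "Const \<alpha> * p + Const \<beta> * q = l * lin (\<lambda>i. \<alpha> * a i + \<beta> * b i)" for \<alpha> \<beta>
      by (simp add: pq ab lin_combination [symmetric] algebra_simps)
    then show ?factors
      unfolding factorizable_def using hom(1) lin_in_Hom by blast
  next
    assume ?binary
    then obtain f g s t where fg: "f \<in> Hom 2 2" "g \<in> Hom 2 2"
      and st: "s \<in> Hom 1 3" "t \<in> Hom 1 3"
      and pq: "p = subst2 f s t" "q = subst2 g s t"
      by blast
    obtain a b c where p: "p = Const a * s\<^sup>2 + Const b * (s * t) + Const c * t\<^sup>2"
      using subst2_Hom_2_2 [OF fg(1)] pq(1) by blast
    obtain a' b' c' where q: "q = Const a' * s\<^sup>2 + Const b' * (s * t) + Const c' * t\<^sup>2"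
      using subst2_Hom_2_2 [OF fg(2)] pq(2) by blast
    have "Const \<alpha> * p + Const \<beta> * q = Const (\<alpha> * a + \<beta> * a') * s\<^sup>2
      + Const (\<alpha> * b + \<beta> * b') * (s * t) + Const (\<alpha> * c + \<beta> * c') * t\<^sup>2" for \<alpha> \<beta>
      by (simp add: p q Const_add [symmetric] Const_mult [symmetric] algebra_simps)
    then show ?factors
      using factorizable_binary [OF st] by metis
  qed
qed

end
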